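(* Let $X$ be a $T$-locally compact topological space and let $Y$ be a closed subset of $X$, equipped with the subspace topology. Then $Y$ is $T$-locally compact.
   Context: A topological space $X$ is called $T$-locally compact at $x \in X$ if for every open set $U$ containing $x$ there exists an open subset $V$ of $X$ containing $x$ such that the boundary $\partial V$ (taken in $X$) is compact and $V \subseteq U$. The space $X$ is called $T$-locally compact if it is $T$-locally compact at each of its points. Compactness does not include the Hausdorff condition. *)

theory Defs
  imports "HOL-Analysis.Abstract_Topology"
begin

definition T_locally_compact_at :: "'a topology \<Rightarrow> 'a \<Rightarrow> bool" where
  "T_locally_compact_at X x \<longleftrightarrow>
     (\<forall>U. openin X U \<and> x \<in> U \<longrightarrow>
        (\<exists>V. openin X V \<and> x \<in> V \<and> compactin X (X frontier_of V) \<and> V \<subseteq> U))"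

definition T_locally_compact_space :: "'a topology \<Rightarrow> bool" where
  "T_locally_compact_space X \<longleftrightarrow> (\<forall>x \<in> topspace X. T_locally_compact_at X x)"

end

theory Submission
  imports Defs
begin

text \<open>A neighbourhood base at a point of \<open>Y\<close> is obtained by tracing on \<open>Y\<close> the open sets
  \<open>V\<close> of \<open>X\<close> that have compact boundary. Passing to the trace creates no new boundary points,
  so the boundary of \<open>V \<inter> Y\<close> in \<open>Y\<close> sits inside the compact boundary of \<open>V\<close>. As it is closed in
  \<open>Y\<close>, and \<open>Y\<close> is closed in \<open>X\<close>, it is a closed subset of a compact set and hence compact.\<close>

text \<open>Neighbourhoods in the subspace are traces of neighbourhoods in \<open>X\<close>, so a point of \<open>S\<close>
  adherent to the trace is adherent to \<open>V\<close>; openness makes the two boundaries the closures with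
  \<open>V \<inter> S\<close>, respectively \<open>V\<close>, removed.\<close>

lemma frontier_of_open_trace_subset:
  assumes "openin X V"
  shows "subtopology X S frontier_of (V \<inter> S) \<subseteq> X frontier_of V"
proof -
  have "openin (subtopology X S) (V \<inter> S)"
    using assms by (auto simp: openin_subtopology)
  then have "subtopology X S frontier_of (V \<inter> S) = subtopology X S closure_of (V \<inter> S) - (V \<inter> S)"
    by (simp add: frontier_of_def interior_of_openin)
  also have "\<dots> \<subseteq> X closure_of V - V"
    using closure_of_mono[of "S \<inter> (V \<inter> S)" V X] by (auto simp: closure_of_subtopology)
  also have "\<dots> = X frontier_of V"
    using assms by (simp add: frontier_of_def interior_of_openin)
  finally show ?thesis .
qed

theorem lemma7:
  fixes X :: "'a topology" and Y :: "'a set"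
  assumes "T_locally_compact_space X"
    and "closedin X Y"
  shows "T_locally_compact_space (subtopology X Y)"
  unfolding T_locally_compact_space_def T_locally_compact_at_def
proof (intro ballI allI impI)
  fix y U'
  assume y: "y \<in> topspace (subtopology X Y)"
    and U': "openin (subtopology X Y) U' \<and> y \<in> U'"
  from U' obtain U where U: "openin X U" "U' = U \<inter> Y"
    by (auto simp: openin_subtopology)
  obtain V where V: "openin X V" "y \<in> V" "compactin X (X frontier_of V)" "V \<subseteq> U"
    using assms(1) y U' U unfolding T_locally_compact_space_def T_locally_compact_at_def
    by (metis IntD1 topspace_subtopology)
  let ?F = "subtopology X Y frontier_of (V \<inter> Y)"
  have "closedin X ?F"
    using closedin_trans_full[OF closedin_frontier_of assms(2)] .
  then have "compactin X ?F"
    using closed_compactin[OF V(3) frontier_of_open_trace_subset[OF V(1)]] by blast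
  moreover have "?F \<subseteq> Y"
    using frontier_of_subset_topspace[of "subtopology X Y" "V \<inter> Y"] by auto
  ultimately have "compactin (subtopology X Y) ?F"
    by (simp add: compactin_subtopology)
  moreover have "openin (subtopology X Y) (V \<inter> Y)"
    using V(1) by (auto simp: openin_subtopology)
  moreover have "y \<in> V \<inter> Y" "V \<inter> Y \<subseteq> U'"
    using V U U' by auto
  ultimately show "\<exists>W. openin (subtopology X Y) W \<and> y \<in> W \<and>
      compactin (subtopology X Y) (subtopology X Y frontier_of W) \<and> W \<subseteq> U'"
    by blast
qed

end
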